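(* For integers $1\le k_1\le k_2\le N-3$, $$W_1(N,k_1,k_2)=\theta^{N-k_1-2}P_{k_1}(P_{N-2})!\Big(\theta^{N-k_2+1}+\theta^{N-k_2+1}P_{k_2-1}\sum_{i=k_2}^{N-2}\frac1{P_i}+\sum_{i=k_1}^{k_2}\frac{P_{N-i-1}}{P_i}+\theta P_{k_2-1}\sum_{i=k_2}^{N-3}\frac{\theta^{i-k_2}P_{N-i-2}}{P_iP_{i+1}}\Big).$$ Moreover, $$W_1(k_2+1,k_1,k_2)=(P_{k_2-1})!\,P_{k_1}\,\theta^{k_2-k_1-1}\Big(\theta^2+\sum_{i=k_1}^{k_2-1}\frac{P_{k_2-i}}{P_i}\Big)$$ and, with $M=k_2+2$, $$W_1(M,k_1,k_2)=\theta^{M-k_1-2}P_{k_1}(P_{M-2})!\Big(\theta^{M-k_2+1}+\theta^{M-k_2+1}\frac{P_{k_2-1}}{P_{k_2}}+\sum_{i=k_1}^{k_2}\frac{P_{M-i-1}}{P_i}\Big).$$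
   Context: Let $\theta>0$. $\mathrm{inv}(\pi)$ is the number of pairs $i<j$ with $\pi_i>\pi_j$. $P_n=1+\theta+\cdots+\theta^{n-1}$, $(P_n)!=P_n\cdots P_1$, $(P_0)!=1$. For $\pi\in S_n$, position $i$ is a left-to-right maximum if $\pi_i>\pi_j$ for all $j<i$, and a left-to-right second maximum if exactly one $j<i$ has $\pi_j>\pi_i$. The $(k_1,k_2)$-strategy accepts the first position $i$ such that either $i>k_1$ and $i$ is a left-to-right maximum, or $i>k_2$ and $i$ is a left-to-right second maximum (if none, the last position is accepted). $\pi\in S_n$ is $(k_1,k_2)$-winnable if the accepted position holds value $n-1$, and $W_1(n,k_1,k_2)=\sum_{\pi\in S_n\ (k_1,k_2)\text{-winnable}}\theta^{\mathrm{inv}(\pi)}$. *)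

theory Defs
  imports Complex_Main "HOL-Combinatorics.Permutations"
begin

text \<open>
  Elements of the symmetric group on \<open>{1..n}\<close> are functions \<open>\<pi>\<close> with \<open>\<pi> permutes {1..n}\<close>; both
  positions \<open>i\<close> and values \<open>\<pi> i\<close> are counted from 1.
\<close>

definition inversions :: "nat \<Rightarrow> (nat \<Rightarrow> nat) \<Rightarrow> nat" where
  "inversions n \<pi> = card {(i, j). 1 \<le> i \<and> i < j \<and> j \<le> n \<and> \<pi> i > \<pi> j}"

definition P :: "real \<Rightarrow> nat \<Rightarrow> real" where
  "P \<theta> n = (\<Sum>j<n. \<theta> ^ j)"

definition P_fact :: "real \<Rightarrow> nat \<Rightarrow> real" where
  "P_fact \<theta> n = (\<Prod>j=1..n. P \<theta> j)"

definition lr_max :: "(nat \<Rightarrow> nat) \<Rightarrow> nat \<Rightarrow> bool" where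
  "lr_max \<pi> i \<longleftrightarrow> (\<forall>j\<in>{1..<i}. \<pi> i > \<pi> j)"

definition lr_second_max :: "(nat \<Rightarrow> nat) \<Rightarrow> nat \<Rightarrow> bool" where
  "lr_second_max \<pi> i \<longleftrightarrow> (\<exists>!j. j \<in> {1..<i} \<and> \<pi> j > \<pi> i)"

definition acceptable :: "nat \<Rightarrow> nat \<Rightarrow> (nat \<Rightarrow> nat) \<Rightarrow> nat \<Rightarrow> bool" where
  "acceptable k1 k2 \<pi> i \<longleftrightarrow> (i > k1 \<and> lr_max \<pi> i) \<or> (i > k2 \<and> lr_second_max \<pi> i)"

definition accepted_position :: "nat \<Rightarrow> nat \<Rightarrow> nat \<Rightarrow> (nat \<Rightarrow> nat) \<Rightarrow> nat" where
  "accepted_position n k1 k2 \<pi> =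
     (if \<exists>i\<in>{1..n}. acceptable k1 k2 \<pi> i
      then LEAST i. i \<in> {1..n} \<and> acceptable k1 k2 \<pi> i
      else n)"

definition winnable :: "nat \<Rightarrow> nat \<Rightarrow> nat \<Rightarrow> (nat \<Rightarrow> nat) \<Rightarrow> bool" where
  "winnable n k1 k2 \<pi> \<longleftrightarrow> \<pi> (accepted_position n k1 k2 \<pi>) = n - 1"

definition W1 :: "real \<Rightarrow> nat \<Rightarrow> nat \<Rightarrow> nat \<Rightarrow> real" where
  "W1 \<theta> n k1 k2 =
     (\<Sum>\<pi> | \<pi> permutes {1..n} \<and> winnable n k1 k2 \<pi>. \<theta> ^ inversions n \<pi>)"

end

theory Submission
  imports Defs
begin

text \<open>
  The number \<open>c\<^sub>i\<close> of earlier entries exceeding \<open>\<pi>\<^sub>i\<close> defines a bijection from permutations to codes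
  with \<open>c\<^sub>i < i\<close>, and the inversion number is \<open>\<Sum>c\<^sub>i\<close>. So under the weight \<open>\<theta>\<close> to the inversion number the
  \<open>c\<^sub>i\<close> are independent. Playing the strategy only requires remembering how many entries so far
  exceed the accepted one, and the next entry increases that number \<open>g\<close> iff its code is at most \<open>g\<close>.
  This is a Markov chain driven by the code; a permutation is winnable iff the chain ends with
  \<open>g = 1\<close>. Backward induction on the position then gives the total weight of winning continuations
  from each state.
\<close>

section \<open>Permutations encoded by independent coordinates\<close>

definition codes :: "nat \<Rightarrow> (nat \<Rightarrow> nat) set" where
  "codes n = PiE {1..n} (\<lambda>i. {..<i})"

definition larger_before :: "(nat \<Rightarrow> nat) \<Rightarrow> nat \<Rightarrow> nat" where
  "larger_before \<pi> i = card {j \<in> {1..<i}. \<pi> j > \<pi> i}"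

definition code :: "nat \<Rightarrow> (nat \<Rightarrow> nat) \<Rightarrow> nat \<Rightarrow> nat" where
  "code n \<pi> = restrict (larger_before \<pi>) {1..n}"

lemma larger_before_less: "1 \<le> i \<Longrightarrow> larger_before \<pi> i < i"
proof -
  assume i: "1 \<le> i"
  have "larger_before \<pi> i \<le> card {1..<i}"
    unfolding larger_before_def by (rule card_mono) auto
  with i show ?thesis by simp
qed

text \<open>\<open>f\<close> and \<open>g\<close> order \<open>A\<close> in the same way, so the two
  sets are upper sets of one ordering. Such sets are nested, and nested finite sets of equal size
  coincide.\<close>

lemma upper_sets_eq:
  fixes f :: "'a \<Rightarrow> nat"
  assumes fin: "finite A"
    and "card {j \<in> A. f j > a} = card {j \<in> A. g j > b}"
    and ord: "\<And>i j. i \<in> A \<Longrightarrow> j \<in> A \<Longrightarrow> f i < f j \<longleftrightarrow> g i < (g j :: nat)"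
  shows "{j \<in> A. f j > a} = {j \<in> A. g j > b}"
proof -
  have "{j \<in> A. f j > a} \<subseteq> {j \<in> A. g j > b} \<or> {j \<in> A. g j > b} \<subseteq> {j \<in> A. f j > a}"
  proof (rule ccontr)
    assume "\<not> ?thesis"
    then obtain i j where "i \<in> A" "j \<in> A" "f i > a" "\<not> g i > b" "\<not> f j > a" "g j > b"
      by blast
    then have "f j < f i" "\<not> g j < g i" by auto
    with ord \<open>i \<in> A\<close> \<open>j \<in> A\<close> show False by blast
  qed
  then show ?thesis
    using assms(1,2) card_subset_eq[of "{j \<in> A. g j > b}" "{j \<in> A. f j > a}"]
      card_subset_eq[of "{j \<in> A. f j > a}" "{j \<in> A. g j > b}"] by auto
qed

text \<open>Induction by insertion: once the first \<open>m\<close> entries are ordered, the code of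
  the next entry says how many of the top ones lie above it, which fixes its place among
  them.\<close>

lemma order_determined_by_code:
  assumes inj: "inj_on \<pi> {1..n}" "inj_on \<sigma> {1..n}"
    and eq: "\<And>i. i \<in> {1..n} \<Longrightarrow> larger_before \<pi> i = larger_before \<sigma> i"
    and "m \<le> n"
  shows "\<forall>i\<in>{1..m}. \<forall>j\<in>{1..m}. \<pi> i < \<pi> j \<longleftrightarrow> \<sigma> i < \<sigma> j"
  using \<open>m \<le> n\<close>
proof (induction m)
  case (Suc m)
  have IH: "\<pi> i < \<pi> j \<longleftrightarrow> \<sigma> i < \<sigma> j" if "i \<in> {1..m}" "j \<in> {1..m}" for i j
    using Suc that by auto
  have "{1..<Suc m} = {1..m}" by auto
  then have above: "{j \<in> {1..m}. \<pi> j > \<pi> (Suc m)} = {j \<in> {1..m}. \<sigma> j > \<sigma> (Suc m)}"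
    using eq[of "Suc m"] Suc.prems unfolding larger_before_def
    by (intro upper_sets_eq IH) auto
  have gt: "\<pi> j > \<pi> (Suc m) \<longleftrightarrow> \<sigma> j > \<sigma> (Suc m)" if "j \<in> {1..m}" for j
    using above that by blast
  have lt: "\<pi> j < \<pi> (Suc m) \<longleftrightarrow> \<sigma> j < \<sigma> (Suc m)" if j: "j \<in> {1..m}" for j
  proof -
    have "\<pi> j \<noteq> \<pi> (Suc m)" "\<sigma> j \<noteq> \<sigma> (Suc m)"
      using j Suc.prems inj_onD[OF inj(1), of j "Suc m"] inj_onD[OF inj(2), of j "Suc m"] by auto
    with gt[OF j] show ?thesis by linarith
  qed
  show ?case using IH gt lt by (auto simp: atLeastAtMostSuc_conv)
qed simp

text \<open>Recovers the values from the relative order, which is what the code determines.\<close>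

lemma permutes_eq_card_less:
  assumes "\<pi> permutes {1..n}" "i \<in> {1..n}"
  shows "\<pi> i = Suc (card {j \<in> {1..n}. \<pi> j < \<pi> i})"
proof -
  have "card {j \<in> {1..n}. \<pi> j < \<pi> i} = card (\<pi> ` {j \<in> {1..n}. \<pi> j < \<pi> i})"
    by (rule card_image[symmetric])
       (use permutes_inj_on[OF assms(1)] in \<open>auto intro: inj_on_subset\<close>)
  also have "\<pi> ` {j \<in> {1..n}. \<pi> j < \<pi> i} = {y \<in> \<pi> ` {1..n}. y < \<pi> i}"
    by auto
  also have "\<dots> = {1..<\<pi> i}"
    using permutes_image[OF assms(1)] permutes_in_image[OF assms(1), of i] assms(2) by auto
  finally show ?thesis
    using permutes_in_image[OF assms(1), of i] assms(2) by simp
qed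

lemma permutes_card_greater:
  assumes "\<pi> permutes {1..n}" "i \<in> {1..n}"
  shows "card {j \<in> {1..n}. \<pi> j > \<pi> i} = n - \<pi> i"
proof -
  have "card {j \<in> {1..n}. \<pi> j > \<pi> i} = card (\<pi> ` {j \<in> {1..n}. \<pi> j > \<pi> i})"
    by (rule card_image[symmetric])
       (use permutes_inj_on[OF assms(1)] in \<open>auto intro: inj_on_subset\<close>)
  also have "\<pi> ` {j \<in> {1..n}. \<pi> j > \<pi> i} = {y \<in> \<pi> ` {1..n}. y > \<pi> i}"
    by auto
  also have "\<dots> = {\<pi> i<..n}"
    using permutes_image[OF assms(1)] by auto
  finally show ?thesis by simp
qed

lemma inj_on_code: "inj_on (code n) {\<pi>. \<pi> permutes {1..n}}"
proof (rule inj_onI, clarify)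
  fix \<pi> \<sigma> assume perm: "\<pi> permutes {1..n}" "\<sigma> permutes {1..n}" and "code n \<pi> = code n \<sigma>"
  then have "larger_before \<pi> i = larger_before \<sigma> i" if "i \<in> {1..n}" for i
    using that unfolding code_def by (metis restrict_apply)
  then have ord: "\<forall>i\<in>{1..n}. \<forall>j\<in>{1..n}. \<pi> i < \<pi> j \<longleftrightarrow> \<sigma> i < \<sigma> j"
    using perm by (intro order_determined_by_code[where n = n] permutes_inj_on) auto
  show "\<pi> = \<sigma>"
  proof
    fix i show "\<pi> i = \<sigma> i"
    proof (cases "i \<in> {1..n}")
      case True
      then have "{j \<in> {1..n}. \<pi> j < \<pi> i} = {j \<in> {1..n}. \<sigma> j < \<sigma> i}" using ord by auto
      then show ?thesis using permutes_eq_card_less[OF _ True] perm by metis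
    qed (use perm permutes_not_in in metis)
  qed
qed

text \<open>Surjectivity comes from counting: both sides have \<open>n!\<close> elements and the map
  is injective.\<close>

lemma bij_betw_code: "bij_betw (code n) {\<pi>. \<pi> permutes {1..n}} (codes n)"
proof -
  have fin: "finite (codes n)" unfolding codes_def by (intro finite_PiE) auto
  have sub: "code n ` {\<pi>. \<pi> permutes {1..n}} \<subseteq> codes n"
    unfolding codes_def code_def by (auto simp: larger_before_less)
  have "card (codes n) = card {\<pi>. \<pi> permutes {1..n}}"
    unfolding codes_def by (simp add: card_PiE card_permutations[of _ n] fact_prod)
  then have "code n ` {\<pi>. \<pi> permutes {1..n}} = codes n"
    using card_image[OF inj_on_code] by (intro card_subset_eq fin sub) simp
  then show ?thesis using inj_on_code by (simp add: bij_betw_def)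
qed

text \<open>Inversions are grouped by their right-hand position.\<close>

lemma inversions_eq_sum: "inversions n \<pi> = (\<Sum>i=1..n. larger_before \<pi> i)"
proof -
  have "bij_betw prod.swap (SIGMA i:{1..n}. {j \<in> {1..<i}. \<pi> j > \<pi> i})
      {(i, j). 1 \<le> i \<and> i < j \<and> j \<le> n \<and> \<pi> i > \<pi> j}"
    by (rule bij_betw_byWitness[where f' = prod.swap]) auto
  then show ?thesis
    unfolding inversions_def larger_before_def
    by (subst bij_betw_same_card[symmetric], assumption, subst card_SigmaI) auto
qed

section \<open>The strategy as a chain driven by the code\<close>

lemma lr_max_iff:
  assumes "inj_on \<pi> {1..n}" "i \<in> {1..n}"
  shows "lr_max \<pi> i \<longleftrightarrow> larger_before \<pi> i = 0"
proof -
  have "\<pi> j \<noteq> \<pi> i" if "j \<in> {1..<i}" for j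
    using inj_onD[OF assms(1), of j i] assms(2) that by auto
  then have "\<pi> i > \<pi> j \<longleftrightarrow> \<not> \<pi> j > \<pi> i" if "j \<in> {1..<i}" for j
    using that by (meson linorder_neqE_nat order_less_asym)
  then show ?thesis unfolding lr_max_def larger_before_def by auto
qed

lemma lr_second_max_iff: "lr_second_max \<pi> i \<longleftrightarrow> larger_before \<pi> i = 1"
proof -
  have "larger_before \<pi> i = 1 \<longleftrightarrow> (\<exists>j. {j \<in> {1..<i}. \<pi> j > \<pi> i} = {j})"
    unfolding larger_before_def One_nat_def by (rule card_1_singleton_iff)
  also have "\<dots> \<longleftrightarrow> lr_second_max \<pi> i"
    unfolding lr_second_max_def by (simp add: set_eq_iff) metis
  finally show ?thesis ..
qed

text \<open>
  \<open>None\<close>: no position accepted yet; \<open>Some g\<close>: \<open>g\<close> entries so far exceed the accepted one.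
\<close>
definition step :: "nat \<Rightarrow> nat \<Rightarrow> nat \<Rightarrow> nat option \<Rightarrow> nat \<Rightarrow> nat option" where
  "step k1 k2 i s x = (case s of
      None \<Rightarrow> if (i > k1 \<and> x = 0) \<or> (i > k2 \<and> x = 1) then Some x else None
    | Some g \<Rightarrow> Some (if x \<le> g then Suc g else g))"

primrec state :: "nat \<Rightarrow> nat \<Rightarrow> nat \<Rightarrow> (nat \<Rightarrow> nat) \<Rightarrow> nat option" where
  "state k1 k2 0 c = None"
| "state k1 k2 (Suc m) c = step k1 k2 (Suc m) (state k1 k2 m c) (c (Suc m))"

lemma state_cong: "(\<And>i. i \<in> {1..m} \<Longrightarrow> c i = d i) \<Longrightarrow> state k1 k2 m c = state k1 k2 m d"
  by (induction m) auto

text \<open>If the new entry exceeds the one at \<open>a\<close>, then whatever exceeds it is among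
  the \<open>g\<close> entries above \<open>\<pi> a\<close>. Otherwise those \<open>g\<close>
  entries and the one at \<open>a\<close> itself all exceed it, so its code is at least
  \<open>g + 1\<close>.\<close>

lemma card_greater_Suc:
  assumes inj: "inj_on \<pi> {1..n}" and a: "a \<in> {1..m}" and m: "Suc m \<le> n"
  defines "g \<equiv> card {j \<in> {1..m}. \<pi> j > \<pi> a}"
  shows "card {j \<in> {1..Suc m}. \<pi> j > \<pi> a} = (if larger_before \<pi> (Suc m) \<le> g then Suc g else g)"
proof -
  have c: "larger_before \<pi> (Suc m) = card {j \<in> {1..m}. \<pi> j > \<pi> (Suc m)}"
    unfolding larger_before_def by (rule arg_cong[where f = card]) auto
  have ne: "\<pi> a \<noteq> \<pi> (Suc m)" using inj_onD[OF inj, of a "Suc m"] a m by auto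
  show ?thesis
  proof (cases "\<pi> (Suc m) > \<pi> a")
    case True
    then have "larger_before \<pi> (Suc m) \<le> g"
      unfolding c g_def by (intro card_mono) auto
    moreover have "{j \<in> {1..Suc m}. \<pi> j > \<pi> a} = insert (Suc m) {j \<in> {1..m}. \<pi> j > \<pi> a}"
      using True by auto
    ultimately show ?thesis unfolding g_def by simp
  next
    case False
    then have "card (insert a {j \<in> {1..m}. \<pi> j > \<pi> a}) \<le> larger_before \<pi> (Suc m)"
      unfolding c using a ne by (intro card_mono) auto
    then have "\<not> larger_before \<pi> (Suc m) \<le> g" unfolding g_def by simp
    moreover have "{j \<in> {1..Suc m}. \<pi> j > \<pi> a} = {j \<in> {1..m}. \<pi> j > \<pi> a}"
      using False by (auto simp: le_Suc_eq)
    ultimately show ?thesis unfolding g_def by simp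
  qed
qed

text \<open>The invariant of the chain. It carries the first acceptable position \<open>a\<close>
  along, so that \<open>a\<close> can later be identified with the \<open>LEAST\<close> in
  \<open>accepted_position\<close>.\<close>

lemma state_larger_before:
  assumes inj: "inj_on \<pi> {1..n}" and "m \<le> n"
  shows "(if \<exists>i\<in>{1..m}. acceptable k1 k2 \<pi> i
      then \<exists>a\<in>{1..m}. acceptable k1 k2 \<pi> a \<and> (\<forall>i\<in>{1..<a}. \<not> acceptable k1 k2 \<pi> i) \<and>
        state k1 k2 m (larger_before \<pi>) = Some (card {j \<in> {1..m}. \<pi> j > \<pi> a})
      else state k1 k2 m (larger_before \<pi>) = None)"
  using \<open>m \<le> n\<close>
proof (induction m)
  case (Suc m)
  let ?c = "larger_before \<pi>"
  have acc: "acceptable k1 k2 \<pi> (Suc m) \<longleftrightarrow>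
      (Suc m > k1 \<and> ?c (Suc m) = 0) \<or> (Suc m > k2 \<and> ?c (Suc m) = 1)"
    unfolding acceptable_def using lr_max_iff[OF inj, of "Suc m"] Suc.prems
    by (simp add: lr_second_max_iff)
  show ?case
  proof (cases "\<exists>i\<in>{1..m}. acceptable k1 k2 \<pi> i")
    case True
    with Suc obtain a where a: "a \<in> {1..m}" "acceptable k1 k2 \<pi> a"
      "\<forall>i\<in>{1..<a}. \<not> acceptable k1 k2 \<pi> i"
      "state k1 k2 m ?c = Some (card {j \<in> {1..m}. \<pi> j > \<pi> a})" by auto
    have "state k1 k2 (Suc m) ?c = Some (card {j \<in> {1..Suc m}. \<pi> j > \<pi> a})"
      unfolding state.simps a(4) card_greater_Suc[OF inj a(1) Suc.prems] by (simp add: step_def)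
    moreover have "\<exists>i\<in>{1..Suc m}. acceptable k1 k2 \<pi> i" "a \<in> {1..Suc m}"
      using a(1,2) by auto
    ultimately show ?thesis using a(2,3) by (simp only: if_True) blast
  next
    case False
    then have none: "state k1 k2 m ?c = None" using Suc by auto
    show ?thesis
    proof (cases "acceptable k1 k2 \<pi> (Suc m)")
      case True
      have "state k1 k2 (Suc m) ?c = Some (?c (Suc m))"
        using True none acc by (simp add: step_def)
      also have "?c (Suc m) = card {j \<in> {1..Suc m}. \<pi> j > \<pi> (Suc m)}"
        unfolding larger_before_def by (rule arg_cong[where f = card]) (auto simp: le_Suc_eq)
      finally have "state k1 k2 (Suc m) ?c = Some (card {j \<in> {1..Suc m}. \<pi> j > \<pi> (Suc m)})" .
      moreover have "\<exists>i\<in>{1..Suc m}. acceptable k1 k2 \<pi> i" "Suc m \<in> {1..Suc m}"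
        "\<forall>i\<in>{1..<Suc m}. \<not> acceptable k1 k2 \<pi> i"
        using True False by auto
      ultimately show ?thesis using True by (simp only: if_True) blast
    next
      case no: False
      then have "\<not> (\<exists>i\<in>{1..Suc m}. acceptable k1 k2 \<pi> i)" using False by (auto simp: le_Suc_eq)
      moreover have "state k1 k2 (Suc m) ?c = None" using none no acc by (simp add: step_def)
      ultimately show ?thesis by simp
    qed
  qed
qed simp

text \<open>An entry has value \<open>n - 1\<close> iff exactly one entry of the whole permutation
  exceeds it, and the final state counts these entries for the accepted position.\<close>

lemma winnable_iff_state:
  assumes perm: "\<pi> permutes {1..n}" and n: "2 \<le> n" "k2 < n"
  shows "winnable n k1 k2 \<pi> \<longleftrightarrow> state k1 k2 n (code n \<pi>) = Some 1"
proof -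
  have inj: "inj_on \<pi> {1..n}" by (rule permutes_inj_on[OF perm])
  have state_code: "state k1 k2 n (code n \<pi>) = state k1 k2 n (larger_before \<pi>)"
    by (rule state_cong) (simp add: code_def)
  have second_iff: "\<pi> a = n - 1 \<longleftrightarrow> card {j \<in> {1..n}. \<pi> j > \<pi> a} = 1" if "a \<in> {1..n}" for a
    using permutes_card_greater[OF perm that] permutes_in_image[OF perm, of a] that n by auto
  show ?thesis
  proof (cases "\<exists>i\<in>{1..n}. acceptable k1 k2 \<pi> i")
    case True
    then obtain a where a: "a \<in> {1..n}" "acceptable k1 k2 \<pi> a"
      "\<forall>i\<in>{1..<a}. \<not> acceptable k1 k2 \<pi> i"
      and state: "state k1 k2 n (larger_before \<pi>) = Some (card {j \<in> {1..n}. \<pi> j > \<pi> a})"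
      using state_larger_before[OF inj order_refl, of k1 k2] by auto
    have "(LEAST i. i \<in> {1..n} \<and> acceptable k1 k2 \<pi> i) = a"
      using a by (intro Least_equality) (auto simp: not_less[symmetric])
    with True have "accepted_position n k1 k2 \<pi> = a"
      unfolding accepted_position_def by (simp only: if_True)
    with state_code state second_iff[OF a(1)] show ?thesis unfolding winnable_def by simp
  next
    case False
    then have "accepted_position n k1 k2 \<pi> = n" unfolding accepted_position_def by simp
    \<comment> \<open>The default acceptance of the last position never wins: holding
      \<open>n - 1\<close> there would make position \<open>n\<close> a second maximum beyond
      \<open>k2\<close>, hence acceptable. So a final \<open>None\<close> rightly counts as a
      loss.\<close>
    moreover have "\<pi> n \<noteq> n - 1"
    proof
      assume "\<pi> n = n - 1"
      then have "card {j \<in> {1..n}. \<pi> j > \<pi> n} = 1" using second_iff[of n] n by auto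
      also have "{j \<in> {1..n}. \<pi> j > \<pi> n} = {j \<in> {1..<n}. \<pi> j > \<pi> n}" by (auto simp: nat_less_le)
      finally have "lr_second_max \<pi> n" by (simp add: lr_second_max_iff larger_before_def)
      with False n show False unfolding acceptable_def by auto
    qed
    moreover have "state k1 k2 n (larger_before \<pi>) = None"
      using state_larger_before[OF inj order_refl, of k1 k2] False by auto
    ultimately show ?thesis using state_code unfolding winnable_def by simp
  qed
qed

section \<open>Weighted sums over codes and backward induction\<close>

definition code_sum :: "real \<Rightarrow> nat \<Rightarrow> nat \<Rightarrow> nat \<Rightarrow> (nat option \<Rightarrow> real) \<Rightarrow> real" where
  "code_sum \<theta> k1 k2 m f = (\<Sum>c\<in>codes m. \<theta> ^ (\<Sum>i=1..m. c i) * f (state k1 k2 m c))"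

lemma code_sum_0: "code_sum \<theta> k1 k2 0 f = f None"
  by (simp add: code_sum_def codes_def)

text \<open>Summing out the last coordinate applies the weighted transition operator of the chain to
  \<open>f\<close>.\<close>

lemma code_sum_Suc:
  "code_sum \<theta> k1 k2 (Suc m) f =
     code_sum \<theta> k1 k2 m (\<lambda>s. \<Sum>x\<le>m. \<theta> ^ x * f (step k1 k2 (Suc m) s x))"
proof -
  let ?h = "\<lambda>(x, c). c(Suc m := x)"
  let ?w = "\<lambda>c. \<theta> ^ (\<Sum>i=1..Suc m. c i) * f (state k1 k2 (Suc m) c)"
  have "codes (Suc m) = ?h ` ({..m} \<times> codes m)"
    using PiE_insert_eq[of "Suc m" "{1..m}" "\<lambda>i. {..<i}"]
    by (simp add: codes_def atLeastAtMostSuc_conv lessThan_Suc_atMost)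
  moreover have "inj_on ?h ({..m} \<times> codes m)"
    unfolding codes_def lessThan_Suc_atMost[symmetric] by (rule inj_combinator) simp
  ultimately have "code_sum \<theta> k1 k2 (Suc m) f = (\<Sum>(x, c)\<in>{..m} \<times> codes m. ?w (c(Suc m := x)))"
    unfolding code_sum_def by (simp only: sum.reindex) (simp add: o_def split_def)
  also have "\<dots> = (\<Sum>c\<in>codes m. \<Sum>x\<le>m. ?w (c(Suc m := x)))"
    unfolding sum.cartesian_product[symmetric] by (rule sum.swap)
  also have "\<dots> = (\<Sum>c\<in>codes m. \<theta> ^ (\<Sum>i=1..m. c i) *
      (\<Sum>x\<le>m. \<theta> ^ x * f (step k1 k2 (Suc m) (state k1 k2 m c) x)))"
  proof (rule sum.cong[OF refl])
    fix c
    have "?w (c(Suc m := x)) = \<theta> ^ (\<Sum>i=1..m. c i) *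
        (\<theta> ^ x * f (step k1 k2 (Suc m) (state k1 k2 m c) x))" for x
    proof -
      have "(\<Sum>i=1..m. (c(Suc m := x)) i) = (\<Sum>i=1..m. c i)" by (rule sum.cong) auto
      moreover have "state k1 k2 m (c(Suc m := x)) = state k1 k2 m c" by (rule state_cong) auto
      ultimately show ?thesis by (simp add: power_add)
    qed
    then show "(\<Sum>x\<le>m. ?w (c(Suc m := x))) = \<theta> ^ (\<Sum>i=1..m. c i) *
        (\<Sum>x\<le>m. \<theta> ^ x * f (step k1 k2 (Suc m) (state k1 k2 m c) x))"
      by (simp only: sum_distrib_left)
  qed
  finally show ?thesis unfolding code_sum_def .
qed

lemma W1_eq_code_sum:
  assumes "2 \<le> n" "k2 < n"
  shows "W1 \<theta> n k1 k2 = code_sum \<theta> k1 k2 n (\<lambda>s. of_bool (s = Some 1))"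
proof -
  have "W1 \<theta> n k1 k2 = (\<Sum>\<pi> | \<pi> permutes {1..n}. of_bool (winnable n k1 k2 \<pi>) * \<theta> ^ inversions n \<pi>)"
    unfolding W1_def by (rule sum.mono_neutral_cong_left) (auto simp: finite_permutations)
  also have "\<dots> = (\<Sum>\<pi> | \<pi> permutes {1..n}. \<theta> ^ (\<Sum>i=1..n. code n \<pi> i) *
      of_bool (state k1 k2 n (code n \<pi>) = Some 1))"
    by (rule sum.cong)
       (simp_all add: winnable_iff_state[OF _ assms] inversions_eq_sum code_def mult.commute)
  also have "\<dots> = code_sum \<theta> k1 k2 n (\<lambda>s. of_bool (s = Some 1))"
    unfolding code_sum_def by (rule sum.reindex_bij_betw[OF bij_betw_code])
  finally show ?thesis .
qed

text \<open>The total weight of the codes at positions \<open>m + 1, ..., n\<close> that lead the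
  chain from state \<open>s\<close> after \<open>m\<close> entries to the final state
  \<open>Some 1\<close>.\<close>

function win_value :: "real \<Rightarrow> nat \<Rightarrow> nat \<Rightarrow> nat \<Rightarrow> nat \<Rightarrow> nat option \<Rightarrow> real" where
  "win_value \<theta> k1 k2 n m s = (if m < n
     then \<Sum>x\<le>m. \<theta> ^ x * win_value \<theta> k1 k2 n (Suc m) (step k1 k2 (Suc m) s x)
     else of_bool (s = Some 1))"
  by pat_completeness auto
termination by (relation "measure (\<lambda>(\<theta>, k1, k2, n, m, s). n - m)") auto

declare win_value.simps [simp del]

text \<open>\<open>win_value\<close> solves the backward equation of the chain, so its weighted sum
  is the same at every time \<open>m\<close>. This allows evaluation at \<open>m = k1\<close>, where
  only the state \<open>None\<close> occurs.\<close>

lemma code_sum_win_value: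
  "m \<le> n \<Longrightarrow> code_sum \<theta> k1 k2 m (win_value \<theta> k1 k2 n m) =
     code_sum \<theta> k1 k2 n (\<lambda>s. of_bool (s = Some 1))"
proof (induction m rule: inc_induct)
  case base
  have "win_value \<theta> k1 k2 n n = (\<lambda>s. of_bool (s = Some 1))" by (rule ext) (simp add: win_value.simps)
  then show ?case by simp
next
  case (step m)
  have "win_value \<theta> k1 k2 n m =
      (\<lambda>s. \<Sum>x\<le>m. \<theta> ^ x * win_value \<theta> k1 k2 n (Suc m) (step k1 k2 (Suc m) s x))"
    by (rule ext) (use step.hyps in \<open>simp add: win_value.simps[of _ _ _ _ m]\<close>)
  then show ?case using step.IH by (simp add: code_sum_Suc)
qed

section \<open>Values of the states of the chain\<close>

lemma P_0 [simp]: "P \<theta> 0 = 0" by (simp add: P_def)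

lemma P_Suc: "P \<theta> (Suc n) = P \<theta> n + \<theta> ^ n" by (simp add: P_def)

lemma P_pos: "\<theta> > 0 \<Longrightarrow> 0 < n \<Longrightarrow> P \<theta> n > 0"
  unfolding P_def by (intro sum_pos) auto

lemma P_fact_0 [simp]: "P_fact \<theta> 0 = 1" by (simp add: P_fact_def)

lemma P_fact_Suc: "P_fact \<theta> (Suc n) = P \<theta> (Suc n) * P_fact \<theta> n" by (simp add: P_fact_def)

text \<open>Fits the transitions that only distinguish code 0 from the rest: from
  \<open>Some 0\<close>, and from \<open>None\<close> while only maxima are accepted.\<close>

lemma sum_powers_tail1: "(\<Sum>x\<le>m. \<theta> ^ x * f x) = f 0 + \<theta> * P \<theta> m * y"
  if "\<And>x. 1 \<le> x \<Longrightarrow> f x = y" for f :: "nat \<Rightarrow> real"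
  using that unfolding lessThan_Suc_atMost[symmetric] P_def
  by (simp only: sum.lessThan_Suc_shift) (simp add: sum_distrib_left sum_distrib_right mult.assoc)

text \<open>Fits the transitions where codes from 2 on behave alike: from \<open>Some 1\<close>, and
  from \<open>None\<close> once second maxima are accepted too.\<close>

lemma sum_powers_tail2: "(\<Sum>x\<le>Suc m. \<theta> ^ x * f x) = f 0 + \<theta> * f 1 + \<theta> ^ 2 * P \<theta> m * y"
  if "\<And>x. 2 \<le> x \<Longrightarrow> f x = y" for f :: "nat \<Rightarrow> real"
  using that unfolding lessThan_Suc_atMost[symmetric] P_def
  by (simp only: sum.lessThan_Suc_shift)
     (simp add: sum_distrib_left sum_distrib_right mult.assoc power2_eq_square)

text \<open>Nothing is acceptable up to \<open>k1\<close>, so all codes of length \<open>m\<close>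
  contribute, with total weight \<open>P_fact \<theta> m\<close>.\<close>

lemma code_sum_None:
  "m \<le> k1 \<Longrightarrow> k1 \<le> k2 \<Longrightarrow> code_sum \<theta> k1 k2 m f = P_fact \<theta> m * f None"
proof (induction m arbitrary: f)
  case (Suc m)
  have "step k1 k2 (Suc m) None x = None" for x using Suc.prems by (simp add: step_def)
  then have "(\<Sum>x\<le>m. \<theta> ^ x * f (step k1 k2 (Suc m) None x)) = P \<theta> (Suc m) * f None"
    by (simp add: P_def lessThan_Suc_atMost sum_distrib_right)
  then show ?case using Suc by (simp add: code_sum_Suc P_fact_Suc)
qed (simp add: code_sum_0)

text \<open>The number of entries above the accepted one never decreases.\<close>

lemma win_value_Some_ge_2: "m \<le> n \<Longrightarrow> 2 \<le> g \<Longrightarrow> win_value \<theta> k1 k2 n m (Some g) = 0"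
proof (induction m arbitrary: g rule: inc_induct)
  case base then show ?case by (simp add: win_value.simps)
next
  case (step m)
  then show ?case by (subst win_value.simps) (auto simp: step_def intro!: sum.neutral)
qed

text \<open>Winning requires every later code to be at least 2, which gives the factor
  \<open>\<theta> ^ 2 * P \<theta> (i - 2)\<close> at each position \<open>i > m\<close>. The
  factorial on the left completes the product and avoids a division.\<close>

lemma win_value_Some_1:
  assumes "2 \<le> m" "m \<le> n"
  shows "win_value \<theta> k1 k2 n m (Some 1) * P_fact \<theta> (m - 2) = \<theta> ^ (2 * (n - m)) * P_fact \<theta> (n - 2)"
  using \<open>m \<le> n\<close> \<open>2 \<le> m\<close>
proof (induction m rule: inc_induct)
  case base then show ?case by (simp add: win_value.simps)
next
  case (step m)
  obtain k where k: "m = Suc (Suc k)" using step.prems by (metis Suc_le_D numeral_2_eq_2 Suc_le_mono)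
  obtain d where d: "n = Suc m + d" using step.hyps less_iff_Suc_add by auto
  have "win_value \<theta> k1 k2 n m (Some 1) =
      (\<Sum>x\<le>Suc (Suc k). \<theta> ^ x * win_value \<theta> k1 k2 n (Suc m) (step k1 k2 (Suc m) (Some 1) x))"
    using step.hyps by (subst win_value.simps) (simp add: k)
  also have "\<dots> = 0 + \<theta> * 0 + \<theta> ^ 2 * P \<theta> (Suc k) * win_value \<theta> k1 k2 n (Suc m) (Some 1)"
    using step.hyps
    by (subst sum_powers_tail2[where y = "win_value \<theta> k1 k2 n (Suc m) (Some 1)"])
       (auto simp: step_def win_value_Some_ge_2)
  finally show ?case
    using step.IH step.prems by (simp add: k d P_fact_Suc power_add power2_eq_square mult_ac)
qed


text \<open>Exactly one later entry, at some position \<open>j\<close>, must exceed the accepted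
  one: codes are at least 1 before \<open>j\<close>, 0 at \<open>j\<close> and at least 2 after it.
  The \<open>P\<close> factors do not depend on \<open>j\<close>, and the powers of
  \<open>\<theta>\<close> add up to \<open>\<theta> ^ (n - m - 1) * P \<theta> (n - m)\<close>. The
  extra \<open>\<theta>\<close> keeps the exponent right at \<open>m = n\<close>.\<close>

lemma win_value_Some_0:
  assumes "2 \<le> m" "m \<le> n"
  shows "\<theta> * win_value \<theta> k1 k2 n m (Some 0) * P_fact \<theta> (m - 1) =
    \<theta> ^ (n - m) * P \<theta> (n - m) * P_fact \<theta> (n - 2)"
  using \<open>m \<le> n\<close> \<open>2 \<le> m\<close>
proof (induction m rule: inc_induct)
  case base then show ?case by (simp add: win_value.simps)
next
  case (step m)
  obtain k where k: "m = Suc (Suc k)" using step.prems by (metis Suc_le_D numeral_2_eq_2 Suc_le_mono)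
  obtain d where d: "n = Suc m + d" using step.hyps less_iff_Suc_add by auto
  let ?A = "win_value \<theta> k1 k2 n (Suc m) (Some 1)" and ?B = "win_value \<theta> k1 k2 n (Suc m) (Some 0)"
  let ?F = "P_fact \<theta> (n - 2)"
  have "win_value \<theta> k1 k2 n m (Some 0) =
      (\<Sum>x\<le>m. \<theta> ^ x * win_value \<theta> k1 k2 n (Suc m) (step k1 k2 (Suc m) (Some 0) x))"
    using step.hyps by (subst win_value.simps) simp
  also have "\<dots> = ?A + \<theta> * P \<theta> m * ?B"
    by (subst sum_powers_tail1[where y = ?B]) (auto simp: step_def)
  finally have "\<theta> * win_value \<theta> k1 k2 n m (Some 0) * P_fact \<theta> (m - 1) =
      \<theta> * (?A * P_fact \<theta> (Suc m - 2)) + \<theta> * (\<theta> * ?B * P_fact \<theta> (Suc m - 1))"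
    by (simp add: k P_fact_Suc algebra_simps)
  also have "?A * P_fact \<theta> (Suc m - 2) = \<theta> ^ (2 * d) * ?F"
    using win_value_Some_1[of "Suc m" n] step.hyps step.prems d by simp
  also have "\<theta> * ?B * P_fact \<theta> (Suc m - 1) = \<theta> ^ d * P \<theta> d * ?F"
    using step.IH step.prems d by simp
  also have "\<theta> * (\<theta> ^ (2 * d) * ?F) + \<theta> * (\<theta> ^ d * P \<theta> d * ?F) =
      \<theta> ^ Suc d * P \<theta> (Suc d) * ?F"
    unfolding mult_2 power_add by (simp add: P_Suc algebra_simps)
  also have "Suc d = n - m" by (simp add: d)
  finally show ?case .
qed

lemma win_value_None_late:
  assumes "k1 \<le> m" "k2 \<le> m" "1 \<le> m" "m < n"
  shows "win_value \<theta> k1 k2 n m None = win_value \<theta> k1 k2 n (Suc m) (Some 0) +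
    \<theta> * win_value \<theta> k1 k2 n (Suc m) (Some 1) + \<theta> ^ 2 * P \<theta> (m - 1) * win_value \<theta> k1 k2 n (Suc m) None"
proof -
  obtain k where k: "m = Suc k" using \<open>1 \<le> m\<close> by (cases m) auto
  have "win_value \<theta> k1 k2 n m None =
      (\<Sum>x\<le>Suc k. \<theta> ^ x * win_value \<theta> k1 k2 n (Suc m) (step k1 k2 (Suc m) None x))"
    using assms by (subst win_value.simps) (simp add: k)
  also have "\<dots> = win_value \<theta> k1 k2 n (Suc m) (Some 0) +
    \<theta> * win_value \<theta> k1 k2 n (Suc m) (Some 1) + \<theta> ^ 2 * P \<theta> k * win_value \<theta> k1 k2 n (Suc m) None"
    using assms
    by (subst sum_powers_tail2[where y = "win_value \<theta> k1 k2 n (Suc m) None"]) (auto simp: step_def)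
  finally show ?thesis by (simp add: k)
qed

lemma win_value_None_early:
  assumes "k1 \<le> m" "m < k2" "m < n"
  shows "win_value \<theta> k1 k2 n m None =
    win_value \<theta> k1 k2 n (Suc m) (Some 0) + \<theta> * P \<theta> m * win_value \<theta> k1 k2 n (Suc m) None"
proof -
  have "win_value \<theta> k1 k2 n m None =
      (\<Sum>x\<le>m. \<theta> ^ x * win_value \<theta> k1 k2 n (Suc m) (step k1 k2 (Suc m) None x))"
    using assms by (subst win_value.simps) simp
  also have "\<dots> = win_value \<theta> k1 k2 n (Suc m) (Some 0) + \<theta> * P \<theta> m * win_value \<theta> k1 k2 n (Suc m) None"
    using assms
    by (subst sum_powers_tail1[where y = "win_value \<theta> k1 k2 n (Suc m) None"]) (auto simp: step_def)
  finally show ?thesis .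
qed

section \<open>The closed form and its recursion\<close>

text \<open>
  The large parenthesis of the theorem for \<open>k\<^sub>1 = m\<close> and \<open>k\<^sub>2 = k\<close>. The half-open ranges make the sums
  empty where the general formula degenerates to the ones for \<open>N = k\<^sub>2 + 1\<close> and \<open>N = k\<^sub>2 + 2\<close>.
\<close>
definition bracket :: "real \<Rightarrow> nat \<Rightarrow> nat \<Rightarrow> nat \<Rightarrow> real" where
  "bracket \<theta> n m k =
     \<theta> ^ (n - k + 1) + \<theta> ^ (n - k + 1) * P \<theta> (k - 1) * (\<Sum>i=k..<n-1. 1 / P \<theta> i)
     + (\<Sum>i=m..<Suc k. P \<theta> (n - i - 1) / P \<theta> i)
     + \<theta> * P \<theta> (k - 1) *
       (\<Sum>i=k..<n-2. \<theta> ^ (i - k) * P \<theta> (n - i - 2) / (P \<theta> i * P \<theta> (i + 1)))"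

text \<open>Lowering the first threshold by one only adds a term to the middle sum, the contribution
  of accepting a maximum at position \<open>m + 1\<close>.\<close>

lemma bracket_early:
  assumes "m < k"
  shows "bracket \<theta> n m k = P \<theta> (n - m - 1) / P \<theta> m + bracket \<theta> n (Suc m) k"
  unfolding bracket_def using assms by (simp add: sum.atLeast_Suc_lessThan[of m])

text \<open>With equal thresholds, every sum loses its first term when both move up by one, and the
  remaining parts rescale by the common factor
  \<open>\<theta> * P \<theta> k / P \<theta> (Suc k)\<close>.\<close>

lemma bracket_late:
  fixes k d :: nat
  assumes "\<theta> > 0"
  defines "n \<equiv> k + d + 3"
  shows "bracket \<theta> n (Suc k) (Suc k) = \<theta> ^ (d + 3) + P \<theta> (d + 1) / P \<theta> (Suc k) +
    \<theta> * P \<theta> k / P \<theta> (Suc k) * bracket \<theta> n (Suc (Suc k)) (Suc (Suc k))"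
proof -
  define S where "S = (\<Sum>i=Suc (Suc k)..<n-1. 1 / P \<theta> i)"
  define T where "T = (\<Sum>i=Suc (Suc k)..<n-2.
    \<theta> ^ (i - Suc (Suc k)) * P \<theta> (n - i - 2) / (P \<theta> i * P \<theta> (i + 1)))"
  have pos: "P \<theta> (Suc k) > 0" "P \<theta> (Suc (Suc k)) > 0" using P_pos[OF \<open>\<theta> > 0\<close>] by auto
  have S: "(\<Sum>i=Suc k..<n-1. 1 / P \<theta> i) = 1 / P \<theta> (Suc k) + S"
    unfolding S_def n_def by (subst sum.atLeast_Suc_lessThan) auto
  have T: "(\<Sum>i=Suc k..<n-2. \<theta> ^ (i - Suc k) * P \<theta> (n - i - 2) / (P \<theta> i * P \<theta> (i + 1))) =
      P \<theta> d / (P \<theta> (Suc k) * P \<theta> (Suc (Suc k))) + \<theta> * T"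
  \<comment> \<open>For \<open>d = 0\<close> there is no term to split off; the identity still holds
    since both sums are empty and \<open>P \<theta> 0 = 0\<close>.\<close>
  proof (cases d)
    case 0
    then show ?thesis by (simp add: T_def n_def)
  next
    case (Suc d')
    have "\<theta> * T = (\<Sum>i=Suc (Suc k)..<n-2.
        \<theta> ^ (i - Suc k) * P \<theta> (n - i - 2) / (P \<theta> i * P \<theta> (i + 1)))"
      unfolding T_def sum_distrib_left
    proof (rule sum.cong[OF refl])
      fix i assume "i \<in> {Suc (Suc k)..<n - 2}"
      then have "i - Suc k = Suc (i - Suc (Suc k))" by auto
      then show "\<theta> * (\<theta> ^ (i - Suc (Suc k)) * P \<theta> (n - i - 2) / (P \<theta> i * P \<theta> (i + 1))) =
        \<theta> ^ (i - Suc k) * P \<theta> (n - i - 2) / (P \<theta> i * P \<theta> (i + 1))" by simp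
    qed
    with Suc show ?thesis
      unfolding n_def by (subst sum.atLeast_Suc_lessThan) (auto simp: numeral_3_eq_3)
  qed
  have "bracket \<theta> n (Suc k) (Suc k) = \<theta> ^ (d + 3) + \<theta> ^ (d + 3) * P \<theta> k * (1 / P \<theta> (Suc k) + S) +
      P \<theta> (d + 1) / P \<theta> (Suc k) +
      \<theta> * P \<theta> k * (P \<theta> d / (P \<theta> (Suc k) * P \<theta> (Suc (Suc k))) + \<theta> * T)"
    unfolding bracket_def S T by (simp add: n_def eval_nat_numeral)
  moreover have "bracket \<theta> n (Suc (Suc k)) (Suc (Suc k)) =
      \<theta> ^ (d + 2) + \<theta> ^ (d + 2) * P \<theta> (Suc k) * S + P \<theta> d / P \<theta> (Suc (Suc k)) + \<theta> * P \<theta> (Suc k) * T"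
    unfolding bracket_def S_def[symmetric] T_def[symmetric] by (simp add: n_def eval_nat_numeral)
  ultimately show ?thesis using pos by (simp only:) (simp add: field_simps eval_nat_numeral)
qed

text \<open>
  From position \<open>m \<ge> k\<^sub>2\<close> on the strategy acts like the \<open>(m, m)\<close>-strategy, hence \<open>max m k\<^sub>2\<close>. The factor
  \<open>\<theta>\<^sup>2\<close> avoids the exponent \<open>n - m - 2\<close>, which is \<open>-1\<close> for \<open>m = n - 1\<close>.
\<close>
lemma win_value_None:
  assumes \<theta>: "\<theta> > 0" and "1 \<le> k1" "k1 \<le> m" "m < n" "k2 < n"
  shows "\<theta> ^ 2 * win_value \<theta> k1 k2 n m None * P_fact \<theta> (m - 1) =
    \<theta> ^ (n - m) * P_fact \<theta> (n - 2) * bracket \<theta> n m (max m k2)"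
proof -
  obtain p where p: "n = Suc p" using \<open>m < n\<close> by (cases n) auto
  then have "m \<le> p" using \<open>m < n\<close> by simp
  then show ?thesis using \<open>k1 \<le> m\<close>
  proof (induction m rule: inc_induct)
    case base
    have "p \<ge> 1" using base \<open>1 \<le> k1\<close> by simp
    \<comment> \<open>With one entry left, only code 1 wins, and its weight is
      \<open>\<theta>\<close>. The bracket here collapses to \<open>\<theta> ^ 2\<close>.\<close>
    have "win_value \<theta> k1 k2 n p None = \<theta>"
      using base \<open>k2 < n\<close> \<open>p \<ge> 1\<close> by (simp add: p win_value_None_late) (simp add: win_value.simps)
    moreover have "max p k2 = p" using \<open>k2 < n\<close> p by simp
    ultimately show ?case by (simp add: p bracket_def power2_eq_square)
  next
    case (step m)
    obtain k where k: "m = Suc k" using step.prems \<open>1 \<le> k1\<close> by (cases m) auto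
    obtain d where d: "p = Suc m + d" using step.hyps less_iff_Suc_add by auto
    have n: "n = k + d + 3" using p d k by simp
    let ?F = "P_fact \<theta> (n - 2)"
    define A where "A = win_value \<theta> k1 k2 n (Suc m) (Some 1)"
    define B where "B = win_value \<theta> k1 k2 n (Suc m) (Some 0)"
    define V where "V = win_value \<theta> k1 k2 n (Suc m) None"
    have pos: "P \<theta> (Suc k) > 0" using P_pos[OF \<theta>] by auto
    have A: "A * P_fact \<theta> k = \<theta> ^ (2 * d + 2) * ?F"
      using win_value_Some_1[of "Suc m" n \<theta> k1 k2] unfolding A_def by (simp add: n k)
    have B: "\<theta> * (B * P_fact \<theta> k) = \<theta> ^ (d + 1) * P \<theta> (d + 1) * ?F / P \<theta> (Suc k)"
      using win_value_Some_0[of "Suc m" n \<theta> k1 k2] pos unfolding B_def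
      by (simp add: n k P_fact_Suc field_simps eval_nat_numeral)
    have V: "\<theta> ^ 2 * (V * P_fact \<theta> k) =
        \<theta> ^ (d + 1) * ?F * bracket \<theta> n (Suc m) (max (Suc m) k2) / P \<theta> (Suc k)"
      using step.IH step.prems pos unfolding V_def
      by (simp add: n k P_fact_Suc field_simps)
    show ?case
    proof (cases "m < k2")
      case True
      \<comment> \<open>Before \<open>k2\<close> the second threshold stays fixed, so the recursion
        matches \<open>bracket_early\<close>.\<close>
      have "win_value \<theta> k1 k2 n m None = B + \<theta> * P \<theta> m * V"
        unfolding B_def V_def using True step d p by (intro win_value_None_early) auto
      then have "\<theta> ^ 2 * win_value \<theta> k1 k2 n m None * P_fact \<theta> (m - 1) =
          \<theta> * (\<theta> * (B * P_fact \<theta> k)) + \<theta> * P \<theta> m * (\<theta> ^ 2 * (V * P_fact \<theta> k))"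
        by (simp add: k algebra_simps power2_eq_square)
      also have "\<dots> = \<theta> ^ (d + 2) * ?F * (P \<theta> (d + 1) / P \<theta> m + bracket \<theta> n (Suc m) k2)"
        unfolding B V using pos True by (simp add: k field_simps max_def)
      also have "\<dots> = \<theta> ^ (n - m) * ?F * bracket \<theta> n m (max m k2)"
        using True by (simp add: bracket_early max_def n k)
      finally show ?thesis .
    next
      case False
      \<comment> \<open>From \<open>k2\<close> on both thresholds of the bracket move with
        \<open>m\<close>, so the recursion matches \<open>bracket_late\<close>.\<close>
      have "win_value \<theta> k1 k2 n m None = B + \<theta> * A + \<theta> ^ 2 * P \<theta> k * V"
        unfolding A_def B_def V_def
        using False step d p k win_value_None_late[of k1 m k2 n \<theta>] by simp
      then have "\<theta> ^ 2 * win_value \<theta> k1 k2 n m None * P_fact \<theta> (m - 1) =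
          \<theta> * (\<theta> * (B * P_fact \<theta> k)) + \<theta> ^ 3 * (A * P_fact \<theta> k) +
          \<theta> ^ 2 * P \<theta> k * (\<theta> ^ 2 * (V * P_fact \<theta> k))"
        by (simp add: k algebra_simps eval_nat_numeral)
      also have "\<dots> = \<theta> ^ (d + 2) * ?F * (\<theta> ^ (d + 3) + P \<theta> (d + 1) / P \<theta> (Suc k) +
          \<theta> * P \<theta> k / P \<theta> (Suc k) * bracket \<theta> n (Suc m) (Suc m))"
        unfolding A B V using pos False
        by (simp add: field_simps max_def power_add mult_2 eval_nat_numeral)
      also have "\<dots> = \<theta> ^ (n - m) * ?F * bracket \<theta> n m (max m k2)"
        using False bracket_late[OF \<theta>, of k d] by (simp add: max_def n k)
      finally show ?thesis .
    qed
  qed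
qed

section \<open>Evaluation at the first threshold and the three formulas\<close>

lemma W1_bracket:
  assumes "\<theta> > 0" "1 \<le> k1" "k1 \<le> k2" "k2 < n"
  shows "\<theta> ^ 2 * W1 \<theta> n k1 k2 =
    \<theta> ^ (n - k1) * P \<theta> k1 * P_fact \<theta> (n - 2) * bracket \<theta> n k1 k2"
proof -
  obtain k where k: "k1 = Suc k" using assms by (cases k1) auto
  have "W1 \<theta> n k1 k2 = code_sum \<theta> k1 k2 k1 (win_value \<theta> k1 k2 n k1)"
    using assms by (simp add: W1_eq_code_sum code_sum_win_value)
  also have "\<dots> = P_fact \<theta> k1 * win_value \<theta> k1 k2 n k1 None"
    using assms by (intro code_sum_None) auto
  finally have "\<theta> ^ 2 * W1 \<theta> n k1 k2 =
      P \<theta> k1 * (\<theta> ^ 2 * win_value \<theta> k1 k2 n k1 None * P_fact \<theta> (k1 - 1))"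
    by (simp add: k P_fact_Suc)
  also have "\<theta> ^ 2 * win_value \<theta> k1 k2 n k1 None * P_fact \<theta> (k1 - 1) =
      \<theta> ^ (n - k1) * P_fact \<theta> (n - 2) * bracket \<theta> n k1 k2"
    using win_value_None[of \<theta> k1 k1 n k2] assms by (simp add: max_def)
  finally show ?thesis by simp
qed

text \<open>For \<open>n\<close> at least \<open>k2 + 2\<close> the exponent
  \<open>n - k1 - 2\<close> is a genuine difference, so \<open>\<theta> ^ 2\<close> can be
  cancelled.\<close>

lemma W1_eq:
  assumes "\<theta> > 0" "1 \<le> k1" "k1 \<le> k2" "k2 + 2 \<le> n"
  shows "W1 \<theta> n k1 k2 = \<theta> ^ (n - k1 - 2) * P \<theta> k1 * P_fact \<theta> (n - 2) * bracket \<theta> n k1 k2"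
proof -
  have "n - k1 = 2 + (n - k1 - 2)" using assms by simp
  then have "\<theta> ^ (n - k1) = \<theta> ^ 2 * \<theta> ^ (n - k1 - 2)" by (metis power_add)
  with W1_bracket[of \<theta> k1 k2 n] assms show ?thesis by simp
qed

theorem theorem14:
  fixes \<theta> :: real and k1 k2 :: nat
  assumes "\<theta> > 0" and "1 \<le> k1" and "k1 \<le> k2"
  shows
    "(\<forall>N. k2 + 3 \<le> N \<longrightarrow>
        W1 \<theta> N k1 k2 =
          \<theta> ^ (N - k1 - 2) * P \<theta> k1 * P_fact \<theta> (N - 2) *
          (\<theta> ^ (N - k2 + 1)
           + \<theta> ^ (N - k2 + 1) * P \<theta> (k2 - 1) * (\<Sum>i=k2..N-2. 1 / P \<theta> i)
           + (\<Sum>i=k1..k2. P \<theta> (N - i - 1) / P \<theta> i)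
           + \<theta> * P \<theta> (k2 - 1) *
               (\<Sum>i=k2..N-3. \<theta> ^ (i - k2) * P \<theta> (N - i - 2) / (P \<theta> i * P \<theta> (i + 1)))))
     \<and> W1 \<theta> (k2 + 1) k1 k2 =
          P_fact \<theta> (k2 - 1) * P \<theta> k1 * \<theta> powi (int k2 - int k1 - 1) *
          (\<theta> ^ 2 + (\<Sum>i=k1..k2-1. P \<theta> (k2 - i) / P \<theta> i))
     \<and> (let M = k2 + 2 in
        W1 \<theta> M k1 k2 =
          \<theta> ^ (M - k1 - 2) * P \<theta> k1 * P_fact \<theta> (M - 2) *
          (\<theta> ^ (M - k2 + 1)
           + \<theta> ^ (M - k2 + 1) * (P \<theta> (k2 - 1) / P \<theta> k2)
           + (\<Sum>i=k1..k2. P \<theta> (M - i - 1) / P \<theta> i)))"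
proof (intro conjI allI impI)
  fix N assume N: "k2 + 3 \<le> N"
  then have "{k2..<N-1} = {k2..N-2}" "{k2..<N-2} = {k2..N-3}" "{k1..<Suc k2} = {k1..k2}"
    by auto
  with W1_eq[of \<theta> k1 k2 N] assms N show "W1 \<theta> N k1 k2 =
          \<theta> ^ (N - k1 - 2) * P \<theta> k1 * P_fact \<theta> (N - 2) *
          (\<theta> ^ (N - k2 + 1)
           + \<theta> ^ (N - k2 + 1) * P \<theta> (k2 - 1) * (\<Sum>i=k2..N-2. 1 / P \<theta> i)
           + (\<Sum>i=k1..k2. P \<theta> (N - i - 1) / P \<theta> i)
           + \<theta> * P \<theta> (k2 - 1) *
               (\<Sum>i=k2..N-3. \<theta> ^ (i - k2) * P \<theta> (N - i - 2) / (P \<theta> i * P \<theta> (i + 1))))"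
    by (simp add: bracket_def)
next
  \<comment> \<open>The last term, at \<open>i = k2\<close>, is
    \<open>P \<theta> 0 / P \<theta> k2 = 0\<close>; the other two sums of the bracket are empty for
    \<open>n = k2 + 1\<close>.\<close>
  have "(\<Sum>i=k1..<Suc k2. P \<theta> (k2 + 1 - i - 1) / P \<theta> i) = (\<Sum>i=k1..<k2. P \<theta> (k2 - i) / P \<theta> i)"
    using assms by simp
  moreover have "{k1..<k2} = {k1..k2-1}" using assms by auto
  ultimately have "bracket \<theta> (k2 + 1) k1 k2 =
      \<theta> ^ 2 + (\<Sum>i=k1..k2-1. P \<theta> (k2 - i) / P \<theta> i)"
    unfolding bracket_def by (simp add: numeral_2_eq_2)
  \<comment> \<open>For \<open>k1 = k2\<close> the exponent on the right is -1, hence the integer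
    power and the separate case \<open>d = 0\<close>.\<close>
  moreover have "\<theta> ^ (k2 + 1 - k1) = \<theta> ^ 2 * \<theta> powi (int k2 - int k1 - 1)"
  proof -
    obtain d where d: "k2 = k1 + d" using assms le_iff_add by blast
    show ?thesis
    proof (cases d)
      case 0
      then show ?thesis using d assms by (simp add: power2_eq_square)
    next
      case (Suc e)
      then have "int k2 - int k1 - 1 = int e" using d by simp
      then show ?thesis using d Suc by (simp add: power2_eq_square)
    qed
  qed
  ultimately show "W1 \<theta> (k2 + 1) k1 k2 =
          P_fact \<theta> (k2 - 1) * P \<theta> k1 * \<theta> powi (int k2 - int k1 - 1) *
          (\<theta> ^ 2 + (\<Sum>i=k1..k2-1. P \<theta> (k2 - i) / P \<theta> i))"
    using W1_bracket[of \<theta> k1 k2 "k2 + 1"] assms by (simp add: mult_ac)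
next
  \<comment> \<open>For \<open>n = k2 + 2\<close> the first sum of the bracket is its single term at
    \<open>k2\<close>, and the last sum is empty.\<close>
  have "{k1..<Suc k2} = {k1..k2}" by auto
  then show "let M = k2 + 2 in
        W1 \<theta> M k1 k2 =
          \<theta> ^ (M - k1 - 2) * P \<theta> k1 * P_fact \<theta> (M - 2) *
          (\<theta> ^ (M - k2 + 1)
           + \<theta> ^ (M - k2 + 1) * (P \<theta> (k2 - 1) / P \<theta> k2)
           + (\<Sum>i=k1..k2. P \<theta> (M - i - 1) / P \<theta> i))"
    using W1_eq[of \<theta> k1 k2 "k2 + 2"] assms by (simp add: bracket_def Let_def eval_nat_numeral)
qed

end
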